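(* The FFCFE$r$ method, which produces $y_1=u(1)$ from $y_0$ with stepsize $h$, exactly preserves the Hamiltonian $H$: $H(y_1)=H(y_0)$.
   Context: Setting. $d=2d_1$, $f:\mathbb{R}^d\to\mathbb{R}^d$ and $H:\mathbb{R}^d\to\mathbb{R}$ are sufficiently smooth (may be read as $C^\infty$), $f=J^{-1}\nabla H$, where $J=\begin{pmatrix}O&I\\-I&O\end{pmatrix}$ with $d_1\times d_1$ blocks. The problem to be solved is $y'(t)=f(y(t))$, $y(t_0)=y_0\in\mathbb{R}^d$; $h>0$ is the stepsize. Function spaces. Let $\varphi_0,\ldots,\varphi_{r-1}$ be sufficiently smooth linearly independent real-valued functions of a real variable. For scalar functions $\psi_i$, $\mathrm{span}\{\psi_0,\ldots,\psi_k\}$ denotes the space of $\mathbb{R}^d$-valued functions $\sum_i W_i\psi_i$ with $W_i\in\mathbb{R}^d$. Put $$Y=\mathrm{span}\{\varphi_0(t),\ldots,\varphi_{r-1}(t)\},\qquad X=\mathrm{span}\Big\{1,\int_{t_0}^t\varphi_0(s)\,ds,\ldots,\int_{t_0}^t\varphi_{r-1}(s)\,ds\Big\}.$$ $Y$ is assumed invariant under translation and reflection: if $v(t)\in Y$ then $v(t+c)\in Y$ for every $c\in\mathbb{R}$ and $v(-t)\in Y$. Define the spaces of functions on $[0,1]$ $$Y_h=\{v: v(\tau)=w(t_0+\tau h),\ w\in Y\},\qquad X_h=\{v: v(\tau)=w(t_0+\tau h),\ w\in X\}$$ (these do not depend on $t_0$ by the invariance). Write $\langle w_1,w_2\rangle=\int_0^1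 w_1(\tau)\cdot w_2(\tau)\,d\tau$, where $\cdot$ is entrywise multiplication for vector-valued functions. FFCFE$r$ method (functionally-fitted continuous finite element method), one step: find $u\in X_h$ with $u(0)=y_0$ such that $\langle v,u'\rangle=h\langle v,f\circ u\rangle$ for all $v\in Y_h$; set $y_1=u(1)$. It is presumed that this variational problem has a unique solution $u$. *)

theory Defs
  imports "HOL-Analysis.Analysis"
begin

text \<open>\<open>C\<^sup>k\<close> on the whole space, by recursion on directional derivatives.\<close>

primrec C_k :: "nat \<Rightarrow> ('a::real_normed_vector \<Rightarrow> 'b::real_normed_vector) \<Rightarrow> bool" where
  "C_k 0 g \<longleftrightarrow> continuous_on UNIV g"
| "C_k (Suc k) g \<longleftrightarrow> g differentiable_on UNIV \<and> (\<forall>v. C_k k (\<lambda>x. frechet_derivative g (at x) v))"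

definition smooth :: "('a::real_normed_vector \<Rightarrow> 'b::real_normed_vector) \<Rightarrow> bool" where
  "smooth g \<longleftrightarrow> (\<forall>k. C_k k g)"

definition gradient :: "('a::real_inner \<Rightarrow> real) \<Rightarrow> 'a \<Rightarrow> 'a" where
  "gradient H x = (THE D. GDERIV H x :> D)"

text \<open>A space of even dimension \<open>d = 2 d\<^sub>1\<close> is \<open>real ^ ('n + 'n)\<close> with \<open>CARD('n) = d\<^sub>1\<close>;
  \<open>Inl\<close> indexes the first block and \<open>Inr\<close> the second.\<close>

definition sympl_J :: "real ^ ('n::finite + 'n) ^ ('n + 'n)" where
  "sympl_J = (\<chi> i j. case (i, j) of
      (Inl a, Inl b) \<Rightarrow> 0
    | (Inl a, Inr b) \<Rightarrow> (if a = b then 1 else 0)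
    | (Inr a, Inl b) \<Rightarrow> (if a = b then - 1 else 0)
    | (Inr a, Inr b) \<Rightarrow> 0)"

definition lin_indep_funs :: "nat \<Rightarrow> (nat \<Rightarrow> real \<Rightarrow> real) \<Rightarrow> bool" where
  "lin_indep_funs r \<phi> \<longleftrightarrow>
     (\<forall>c. (\<forall>t. (\<Sum>i<r. c i * \<phi> i t) = 0) \<longrightarrow> (\<forall>i<r. c i = 0))"

text \<open>Span of the scalar functions \<open>\<psi> 0, \<dots>, \<psi> (k - 1)\<close> with vector coefficients.\<close>

definition vspan :: "nat \<Rightarrow> (nat \<Rightarrow> real \<Rightarrow> real) \<Rightarrow> (real \<Rightarrow> 'v::real_vector) set" where
  "vspan k \<psi> = {v. \<exists>W. v = (\<lambda>t. \<Sum>i<k. \<psi> i t *\<^sub>R W i)}"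

definition Y_space :: "nat \<Rightarrow> (nat \<Rightarrow> real \<Rightarrow> real) \<Rightarrow> (real \<Rightarrow> 'v::real_vector) set" where
  "Y_space r \<phi> = vspan r \<phi>"

text \<open>The interval integral is oriented, so it is the right one also for \<open>t < t0\<close>.\<close>

definition X_gen :: "real \<Rightarrow> (nat \<Rightarrow> real \<Rightarrow> real) \<Rightarrow> nat \<Rightarrow> real \<Rightarrow> real" where
  "X_gen t0 \<phi> i t = (case i of 0 \<Rightarrow> 1 | Suc j \<Rightarrow> (LBINT s=ereal t0..ereal t. \<phi> j s))"

definition X_space :: "real \<Rightarrow> nat \<Rightarrow> (nat \<Rightarrow> real \<Rightarrow> real) \<Rightarrow> (real \<Rightarrow> 'v::real_vector) set" where
  "X_space t0 r \<phi> = vspan (Suc r) (X_gen t0 \<phi>)"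

definition transl_refl_invariant :: "(real \<Rightarrow> 'v) set \<Rightarrow> bool" where
  "transl_refl_invariant Y \<longleftrightarrow>
     (\<forall>v\<in>Y. (\<forall>c. (\<lambda>t. v (t + c)) \<in> Y) \<and> (\<lambda>t. v (- t)) \<in> Y)"

text \<open>Functions on \<open>[0,1]\<close> are represented extensionally (\<open>undefined\<close> outside \<open>[0,1]\<close>),
  so that equality of functions is equality on \<open>[0,1]\<close>.\<close>

definition rescale :: "real \<Rightarrow> real \<Rightarrow> (real \<Rightarrow> 'v) set \<Rightarrow> (real \<Rightarrow> 'v) set" where
  "rescale t0 h S = {v. \<exists>w\<in>S. v = (\<lambda>\<tau>\<in>{0..1}. w (t0 + \<tau> * h))}"

definition Y_h :: "real \<Rightarrow> real \<Rightarrow> nat \<Rightarrow> (nat \<Rightarrow> real \<Rightarrow> real) \<Rightarrow> (real \<Rightarrow> 'v::real_vector) set" where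
  "Y_h t0 h r \<phi> = rescale t0 h (Y_space r \<phi>)"

definition X_h :: "real \<Rightarrow> real \<Rightarrow> nat \<Rightarrow> (nat \<Rightarrow> real \<Rightarrow> real) \<Rightarrow> (real \<Rightarrow> 'v::real_vector) set" where
  "X_h t0 h r \<phi> = rescale t0 h (X_space t0 r \<phi>)"

text \<open>On \<open>real ^ 'm\<close> the product \<open>*\<close> is entrywise, so this bracket is vector-valued.\<close>

definition bracket :: "(real \<Rightarrow> real ^ 'm) \<Rightarrow> (real \<Rightarrow> real ^ 'm) \<Rightarrow> real ^ 'm" where
  "bracket w1 w2 = (LBINT \<tau>=0..1. w1 \<tau> * w2 \<tau>)"

definition ffcfe_solution ::
  "nat \<Rightarrow> (nat \<Rightarrow> real \<Rightarrow> real) \<Rightarrow> (real ^ 'm \<Rightarrow> real ^ 'm) \<Rightarrow> real \<Rightarrow> real \<Rightarrow> real ^ 'm \<Rightarrow>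
   (real \<Rightarrow> real ^ 'm) \<Rightarrow> bool" where
  "ffcfe_solution r \<phi> f t0 h y0 u \<longleftrightarrow>
     u \<in> X_h t0 h r \<phi> \<and> u 0 = y0 \<and>
     (\<forall>v \<in> Y_h t0 h r \<phi>.
        bracket v (\<lambda>\<tau>. vector_derivative u (at \<tau> within {0..1})) = h *\<^sub>R bracket v (f \<circ> u))"

definition ffcfe_step ::
  "nat \<Rightarrow> (nat \<Rightarrow> real \<Rightarrow> real) \<Rightarrow> (real ^ 'm \<Rightarrow> real ^ 'm) \<Rightarrow> real \<Rightarrow> real \<Rightarrow> real ^ 'm \<Rightarrow> real ^ 'm" where
  "ffcfe_step r \<phi> f t0 h y0 = (THE u. ffcfe_solution r \<phi> f t0 h y0 u) 1"

end

theory Submission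
  imports Defs
begin

text \<open>
  On \<open>[0,1]\<close> we have \<open>u' = h P\<close> with \<open>P\<close> in \<open>Y_h\<close>, and \<open>J P\<close> is again in \<open>Y_h\<close>
  because the coefficients of \<open>Y\<close> are arbitrary vectors. Testing the variational equation with
  \<open>v = J P\<close> and summing the components gives \<open>\<integral> J P \<bullet> f(u) = \<integral> J P \<bullet> P = 0\<close>, as \<open>J\<close> is
  skew. Since \<open>\<nabla>H = J f\<close>, skewness also turns the left-hand side into \<open>- \<integral> P \<bullet> \<nabla>H(u)\<close>,
  and \<open>h\<close> times this is \<open>H(y0) - H(y1)\<close>.
\<close>

lemma sum_UNIV_Plus:
  fixes g :: "'a::finite + 'b::finite \<Rightarrow> 'c::comm_monoid_add"
  shows "(\<Sum>i\<in>UNIV. g i) = (\<Sum>a\<in>UNIV. g (Inl a)) + (\<Sum>b\<in>UNIV. g (Inr b))"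
  unfolding UNIV_Plus_UNIV[symmetric] by (subst sum.Plus) simp_all

lemma sympl_J_mult_Inl: "(sympl_J *v x) $ Inl a = x $ Inr a"
  by (simp add: matrix_vector_mult_def sympl_J_def sum_UNIV_Plus if_distrib[of "\<lambda>c. c * _"]
      cong: if_cong)

lemma sympl_J_mult_Inr: "(sympl_J *v x) $ Inr a = - x $ Inl a"
  by (simp add: matrix_vector_mult_def sympl_J_def sum_UNIV_Plus if_distrib[of "\<lambda>c. c * _"]
      cong: if_cong)

lemma sympl_J_sympl_J:
  fixes x :: "real ^ ('a::finite + 'a)"
  shows "sympl_J *v (sympl_J *v x) = - x"
  unfolding vec_eq_iff
proof
  fix i :: "'a + 'a"
  show "(sympl_J *v (sympl_J *v x)) $ i = (- x) $ i"
    by (cases i) (simp_all add: sympl_J_mult_Inl sympl_J_mult_Inr)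
qed

lemma sympl_J_skew: "(sympl_J *v x) \<bullet> y = - (x \<bullet> (sympl_J *v y))"
  by (simp add: inner_vec_def sum_UNIV_Plus sympl_J_mult_Inl sympl_J_mult_Inr sum_negf)

text \<open>As J squares to -1, its fourth power is the identity and its cube is a right inverse,
  which suffices for a square matrix. Invertibility is what makes \<open>matrix_inv\<close>, a
  choice, a true inverse; the lemma then turns the formula for \<open>f\<close> into J f = grad
  H.\<close>

lemma sympl_J_mult_matrix_inv:
  fixes x :: "real ^ ('a::finite + 'a)"
  shows "sympl_J *v (matrix_inv sympl_J *v x) = x"
proof -
  have "sympl_J ** (sympl_J ** (sympl_J ** sympl_J)) = (mat 1 :: real ^ ('a + 'a) ^ ('a + 'a))"
    by (simp add: matrix_eq matrix_vector_mul_assoc[symmetric] sympl_J_sympl_J)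
  then have "invertible (sympl_J :: real ^ ('a + 'a) ^ ('a + 'a))"
    using invertible_right_inverse by blast
  then show ?thesis
    unfolding matrix_inv_def invertible_def
    by (metis (mono_tags, lifting) matrix_vector_mul_assoc matrix_vector_mul_lid someI_ex)
qed

text \<open>\<open>gradient\<close> is a definite description, so existence and uniqueness are both
  at stake. The real-valued linear derivative \<open>L\<close> is the inner product with
  \<open>adjoint L 1\<close> (Riesz); uniqueness of derivatives rules out any other vector.\<close>

lemma GDERIV_gradient:
  fixes H :: "'a::euclidean_space \<Rightarrow> real"
  assumes "H differentiable (at x)"
  shows "GDERIV H x :> gradient H x"
proof -
  obtain L where L: "(H has_derivative L) (at x)"
    using assms by (auto simp: differentiable_def)
  interpret bounded_linear L using L by (rule has_derivative_bounded_linear)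
  have "L = (\<lambda>h. h \<bullet> adjoint L 1)"
    by (rule ext) (simp add: adjoint_works linear_axioms)
  with L have D: "GDERIV H x :> adjoint L 1"
    unfolding gderiv_def by metis
  show ?thesis
    unfolding gradient_def
  proof (rule theI[where P="\<lambda>D. GDERIV H x :> D"], rule D)
    fix E assume "GDERIV H x :> E"
    then have "(\<lambda>h. h \<bullet> E) = (\<lambda>h. h \<bullet> adjoint L 1)"
      using D unfolding gderiv_def by (rule has_derivative_unique)
    then show "E = adjoint L 1"
      by (metis vector_eq_ldot)
  qed
qed

lemma smooth_continuous_on: "smooth g \<Longrightarrow> continuous_on S g"
  unfolding smooth_def by (metis C_k.simps(1) continuous_on_subset subset_UNIV)

lemma smooth_differentiable: "smooth g \<Longrightarrow> g differentiable (at x)"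
  unfolding smooth_def using C_k.simps(2)[of 0 g] by (auto simp: differentiable_on_def)

lemma has_vector_derivative_LBINT:
  fixes g :: "real \<Rightarrow> 'a::euclidean_space"
  assumes "continuous_on UNIV g"
  shows "((\<lambda>t. LBINT s=ereal a..ereal t. g s) has_vector_derivative g t) (at t)"
proof -
  \<comment> \<open>The margin 1 puts both \<open>a\<close> and \<open>t\<close> in the interior,
    whichever is larger, so the derivative within the interval is the two-sided one.\<close>
  let ?l = "min a t - 1" and ?u = "max a t + 1"
  have "((\<lambda>t. LBINT s=ereal a..ereal t. g s) has_vector_derivative g t) (at t within {?l..?u})"
    by (rule interval_integral_FTC2) (auto intro: continuous_on_subset[OF assms])
  moreover have "at t within {?l..?u} = at t"
    by (rule at_within_interior) (auto simp: interior_atLeastAtMost_real)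
  ultimately show ?thesis by simp
qed

text \<open>Adding up the entries of the entrywise bracket gives the L2 inner product. The
  continuous \<open>g1\<close>, \<open>g2\<close> stand in for \<open>w1\<close>, \<open>w2\<close>,
  about which nothing is known outside \<open>{0..1}\<close>.\<close>

lemma sum_bracket:
  fixes w1 w2 :: "real \<Rightarrow> real ^ 'm"
  assumes "\<And>t. t \<in> {0..1} \<Longrightarrow> w1 t = g1 t" "\<And>t. t \<in> {0..1} \<Longrightarrow> w2 t = g2 t"
    and "continuous_on {0..1} g1" "continuous_on {0..1} g2"
  shows "(\<Sum>i\<in>UNIV. bracket w1 w2 $ i) = integral {0..1} (\<lambda>t. g1 t \<bullet> g2 t)"
proof -
  let ?S = "\<lambda>x::real ^ 'm. \<Sum>i\<in>UNIV. x $ i"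
  have cont: "continuous_on {0..1} (\<lambda>t. g1 t * g2 t)"
  proof -
    have "(\<lambda>t. g1 t * g2 t) = (\<lambda>t. \<chi> i. g1 t $ i * g2 t $ i)"
      by (simp add: vec_eq_iff fun_eq_iff)
    then show ?thesis
      by (simp only:) (intro continuous_intros assms(3,4))
  qed
  have "bracket w1 w2 = (LBINT t=ereal 0..ereal 1. g1 t * g2 t)"
    unfolding bracket_def zero_ereal_def one_ereal_def
    by (rule interval_integral_cong) (auto simp: assms(1,2))
  also have "\<dots> = integral {0..1} (\<lambda>t. g1 t * g2 t)"
    by (rule interval_integral_eq_integral) (auto intro!: borel_integrable_atLeastAtMost' cont)
  finally have "?S (bracket w1 w2) = ?S (integral {0..1} (\<lambda>t. g1 t * g2 t))"
    by simp
  \<comment> \<open>Summing coordinates is bounded linear and so commutes with the integral.\<close>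
  also have "\<dots> = integral {0..1} (?S \<circ> (\<lambda>t. g1 t * g2 t))"
    by (intro integral_linear[symmetric] integrable_continuous_interval cont bounded_linear_sum
        bounded_linear_vec_nth)
  finally show ?thesis
    by (simp add: o_def inner_vec_def)
qed

theorem theorem2p3:
  fixes f :: "real ^ ('n::finite + 'n) \<Rightarrow> real ^ ('n + 'n)"
    and H :: "real ^ ('n + 'n) \<Rightarrow> real"
    and \<phi> :: "nat \<Rightarrow> real \<Rightarrow> real"
    and r :: nat
    and t0 h :: real
    and y0 :: "real ^ ('n + 'n)"
  assumes "smooth f" and "smooth H"
    and "\<And>y. f y = matrix_inv sympl_J *v gradient H y"
    and "r \<ge> 1"
    and "\<And>i. i < r \<Longrightarrow> smooth (\<phi> i)"
    and "lin_indep_funs r \<phi>"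
    and "transl_refl_invariant (Y_space r \<phi> :: (real \<Rightarrow> real ^ ('n + 'n)) set)"
    and "h > 0"
    and "\<exists>!u. ffcfe_solution r \<phi> f t0 h y0 u"
  shows "H (ffcfe_step r \<phi> f t0 h y0) = H y0"
proof -
  define u where "u = (THE u. ffcfe_solution r \<phi> f t0 h y0 u)"
  have sol: "ffcfe_solution r \<phi> f t0 h y0 u"
    unfolding u_def using assms(9) by (rule theI')
  then have u0: "u 0 = y0" and "u \<in> X_h t0 h r \<phi>"
    and var: "\<And>v. v \<in> Y_h t0 h r \<phi> \<Longrightarrow>
      bracket v (\<lambda>\<tau>. vector_derivative u (at \<tau> within {0..1})) = h *\<^sub>R bracket v (f \<circ> u)"
    unfolding ffcfe_solution_def by auto
  then obtain W where W: "u = (\<lambda>\<tau>\<in>{0..1}. \<Sum>i<Suc r. X_gen t0 \<phi> i (t0 + \<tau> * h) *\<^sub>R W i)"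
    unfolding X_h_def rescale_def X_space_def vspan_def by auto
  \<comment> \<open>\<open>u\<close> is \<open>undefined\<close> outside \<open>{0..1}\<close>;
    \<open>U\<close> continues the same formula to the whole line and so has two-sided derivatives
    even at 0 and 1.\<close>
  define U where "U \<tau> = (\<Sum>i<Suc r. X_gen t0 \<phi> i (t0 + \<tau> * h) *\<^sub>R W i)" for \<tau>
  \<comment> \<open>The coefficient \<open>W 0\<close> belongs to the constant function 1 and
    disappears on differentiation; \<open>W (Suc i)\<close> belongs to the integral of
    \<open>\<phi> i\<close>, hence the index shift.\<close>
  define P where "P \<tau> = (\<Sum>i<r. \<phi> i (t0 + \<tau> * h) *\<^sub>R W (Suc i))" for \<tau>
  have uU: "u \<tau> = U \<tau>" if "\<tau> \<in> {0..1}" for \<tau>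
    using that by (simp add: W U_def)
  have cont_\<phi>: "continuous_on S (\<phi> i)" if "i < r" for i S
    using assms(5)[OF that] by (rule smooth_continuous_on)
  have dU: "(U has_vector_derivative h *\<^sub>R P \<tau>) (at \<tau>)" for \<tau>
  proof -
    have "((\<lambda>\<tau>. LBINT s=ereal t0..ereal (t0 + \<tau> * h). \<phi> i s) has_vector_derivative
        h *\<^sub>R \<phi> i (t0 + \<tau> * h)) (at \<tau>)" if "i < r" for i
    proof -
      have "((\<lambda>\<tau>. t0 + \<tau> * h) has_vector_derivative h) (at \<tau>)"
        by (auto simp: has_real_derivative_iff_has_vector_derivative[symmetric]
            intro!: derivative_eq_intros)
      from vector_diff_chain_at[OF this has_vector_derivative_LBINT[OF cont_\<phi>[OF that]]]
      show ?thesis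
        by (simp add: o_def)
    qed
    then have "((\<lambda>\<tau>. W 0 + (\<Sum>i<r. (LBINT s=ereal t0..ereal (t0 + \<tau> * h). \<phi> i s) *\<^sub>R W (Suc i)))
        has_vector_derivative 0 + (\<Sum>i<r. (h *\<^sub>R \<phi> i (t0 + \<tau> * h)) *\<^sub>R W (Suc i))) (at \<tau>)"
      by (intro has_vector_derivative_add has_vector_derivative_const has_vector_derivative_sum
          bounded_linear.has_vector_derivative[OF bounded_linear_scaleR_left]) auto
    moreover have "U = (\<lambda>\<tau>. W 0 +
        (\<Sum>i<r. (LBINT s=ereal t0..ereal (t0 + \<tau> * h). \<phi> i s) *\<^sub>R W (Suc i)))"
      by (simp add: U_def fun_eq_iff sum.lessThan_Suc_shift X_gen_def del: sum.lessThan_Suc)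
    ultimately show ?thesis
      by (simp add: P_def scaleR_sum_right)
  qed
  have contP: "continuous_on {0..1} P"
    unfolding P_def
    by (intro continuous_intros continuous_on_compose2[OF cont_\<phi>[of _ UNIV]]) auto
  have contU: "continuous_on {0..1} U"
    using dU by (meson has_vector_derivative_continuous continuous_at_imp_continuous_on)
  have contJP: "continuous_on {0..1} (\<lambda>\<tau>. sympl_J *v P \<tau>)"
    by (intro matrix_vector_mult_linear_continuous_on continuous_on_compose2[OF _ contP]) auto
  have contfU: "continuous_on {0..1} (\<lambda>\<tau>. f (U \<tau>))"
    by (rule continuous_on_compose2[OF smooth_continuous_on[OF assms(1), of UNIV] contU]) auto
  \<comment> \<open>Agreement of \<open>u\<close> and \<open>U\<close> on \<open>{0..1}\<close> is
    enough here, because the derivative is taken within that interval and is one-sided at its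
    ends.\<close>
  have du: "vector_derivative u (at \<tau> within {0..1}) = h *\<^sub>R P \<tau>" if "\<tau> \<in> {0..1}" for \<tau>
  proof (rule vector_derivative_within_closed_interval)
    show "(u has_vector_derivative h *\<^sub>R P \<tau>) (at \<tau> within {0..1})"
      using has_vector_derivative_transform[OF that uU has_vector_derivative_at_within[OF dU]] .
  qed (use that in auto)
  define v where "v = (\<lambda>\<tau>\<in>{0..1}. sympl_J *v P \<tau>)"
  have "v \<in> Y_h t0 h r \<phi>"
    unfolding Y_h_def rescale_def Y_space_def vspan_def
  proof (intro CollectI bexI exI)
    \<comment> \<open>By linearity J moves onto the coefficients. This fixes the element of Y to be
      rescaled, and the closing reflexivity step reads off its coefficients
      \<open>sympl_J *v W (Suc i)\<close>.\<close>
    show "v = (\<lambda>\<tau>\<in>{0..1}. (\<lambda>t. \<Sum>i<r. \<phi> i t *\<^sub>R (sympl_J *v W (Suc i))) (t0 + \<tau> * h))"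
      by (simp add: v_def P_def linear_sum[OF matrix_vector_mul_linear]
          linear_cmul[OF matrix_vector_mul_linear])
  qed rule
  from var[OF this]
  have "(\<Sum>i\<in>UNIV. bracket v (\<lambda>\<tau>. vector_derivative u (at \<tau> within {0..1})) $ i) =
      h * (\<Sum>i\<in>UNIV. bracket v (f \<circ> u) $ i)"
    by (simp add: sum_distrib_left)
  moreover have "(\<Sum>i\<in>UNIV. bracket v (\<lambda>\<tau>. vector_derivative u (at \<tau> within {0..1})) $ i) =
      integral {0..1} (\<lambda>\<tau>. (sympl_J *v P \<tau>) \<bullet> (h *\<^sub>R P \<tau>))"
    by (rule sum_bracket) (auto simp: v_def du intro!: contJP continuous_intros contP)
  moreover have "(\<Sum>i\<in>UNIV. bracket v (f \<circ> u) $ i) =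
      integral {0..1} (\<lambda>\<tau>. (sympl_J *v P \<tau>) \<bullet> f (U \<tau>))"
    by (rule sum_bracket) (auto simp: v_def uU intro!: contJP contfU)
  moreover have "(sympl_J *v x) \<bullet> x = 0" for x :: "real ^ ('n + 'n)"
    using sympl_J_skew[of x x] by (simp add: inner_commute)
  moreover have "(sympl_J *v x) \<bullet> f y = - (x \<bullet> gradient H y)" for x y
    by (simp add: sympl_J_skew assms(3) sympl_J_mult_matrix_inv)
  \<comment> \<open>The factor \<open>h\<close> is kept: \<open>h\<close> times this integral is
    exactly the increment of \<open>H\<close> along \<open>U\<close>.\<close>
  ultimately have int0: "h * integral {0..1} (\<lambda>\<tau>. P \<tau> \<bullet> gradient H (U \<tau>)) = 0"
    by simp
  have "((\<lambda>\<tau>. H (U \<tau>)) has_vector_derivative h * (P \<tau> \<bullet> gradient H (U \<tau>))) (at \<tau>)" for \<tau>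
  proof -
    have "(H has_derivative (\<lambda>v. v \<bullet> gradient H (U \<tau>))) (at (U \<tau>))"
      using GDERIV_gradient[OF smooth_differentiable[OF assms(2)]] by (simp add: gderiv_def)
    from has_derivative_compose[OF dU[of \<tau>, unfolded has_vector_derivative_def] this]
    show ?thesis
      by (simp add: has_vector_derivative_def inner_commute mult.assoc mult.commute o_def)
  qed
  then have "((\<lambda>\<tau>. h * (P \<tau> \<bullet> gradient H (U \<tau>))) has_integral H (U 1) - H (U 0)) {0..1}"
    by (intro fundamental_theorem_of_calculus) (auto intro: has_vector_derivative_at_within)
  then have "H (U 1) - H (U 0) = integral {0..1} (\<lambda>\<tau>. h * (P \<tau> \<bullet> gradient H (U \<tau>)))"
    by (rule integral_unique[symmetric])
  then have "H (U 1) = H (U 0)"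
    using int0 by simp
  \<comment> \<open>Both endpoints lie in \<open>{0..1}\<close>, so \<open>U 0\<close> is
    \<open>y0\<close> and \<open>U 1\<close> is the value \<open>u 1\<close> returned by the
    step.\<close>
  then show ?thesis
    using u0 uU[of 0] uU[of 1] by (simp add: ffcfe_step_def u_def[symmetric])
qed

end
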